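(* Let $(G,\omega)$ be a symplectic Lie group (of any dimension) with Lie algebra $\mathfrak g$, and let $$\nabla_xy=\tfrac23xy-\tfrac13yx,\qquad x,y\in\mathfrak g,$$ be the symplectic torsion free left-invariant connection naturally associated to the compatible structure $(x,y)\mapsto xy$ of left-symmetric algebra on $\mathfrak g$ defined by $\omega(xy,z)=-\omega(y,[x,z])$. Then the Ricci tensor of $\nabla$ is given by $$\operatorname{ric}^\nabla(x,y)=\tfrac19\big(\mathrm{tr}(L_{xy})+\mathrm{tr}(L_x\circ L_y)\big)$$ for all $x,y\in\mathfrak g$. If $(G,\omega)$ is a nilpotent symplectic Lie group, then $\operatorname{ric}^\nabla=0$.
   Context: A symplectic Lie group is a Lie group $G$ with a left-invariant symplectic form $\omega$; equivalently $\omega$ is a nondegenerate scalar $2$-cocycle on $\mathfrak g$. $\mathfrak g$ is identified with the left-invariant vector fields. The bilinear product $xy$ on $\mathfrak g$ is determined by $\omega(xy,z)=-\omega(y,[x,z])$ for all $x,y,z\in\mathfrak g$; it satisfies $(xy)z-x(yz)=(yx)z-y(xz)$ and $[x,y]=xy-yx$. $L_x:y\mapsto xy$ denotes left multiplication. Conventions: $R(x,y)=[\nabla_x,\nabla_y]-\nabla_{[x,y]}$ and $\operatorname{ric}^\nabla(x,y)=\mathrm{tr}\{z\mapsto R(x,z)y\}$. *)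

theory Defs
  imports "HOL-Analysis.Analysis"
begin

text \<open>
  A Lie group \<open>G\<close> enters only through its Lie algebra of left-invariant vector fields. That Lie
  algebra is carried by a whole type of class \<open>real_vector\<close> rather than \<open>euclidean_space\<close>: no inner
  product is part of the data, and the dimension may be zero. Left-invariant forms, connections and
  tensors on \<open>G\<close> are the corresponding multilinear maps on the Lie algebra.
\<close>

section \<open>Trace of an endomorphism\<close>

definition is_finite_basis :: "'a::real_vector set \<Rightarrow> bool"
  where "is_finite_basis B \<longleftrightarrow> finite B \<and> independent B \<and> span B = UNIV"

definition trace_wrt :: "'a::real_vector set \<Rightarrow> ('a \<Rightarrow> 'a) \<Rightarrow> real"
  where "trace_wrt B f = (\<Sum>b\<in>B. representation B (f b) b)"

text \<open>The choice of basis is immaterial for linear \<open>f\<close>; see \<open>endo_trace_eq\<close> below.\<close>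

definition endo_trace :: "('a::real_vector \<Rightarrow> 'a) \<Rightarrow> real"
  where "endo_trace f = trace_wrt (SOME B. is_finite_basis B) f"

lemma trace_wrt_basis_independent:
  fixes f :: "'a::real_vector \<Rightarrow> 'a"
  assumes B: "is_finite_basis B" and C: "is_finite_basis C" and f: "linear f"
  shows "trace_wrt B f = trace_wrt C f"
proof -
  have fB: "finite B" "independent B" and sB: "\<And>x. x \<in> span B"
    and fC: "finite C" "independent C" and sC: "\<And>x. x \<in> span C"
    using B C by (auto simp: is_finite_basis_def)
  have repr_sum: "representation B (\<Sum>i\<in>I. r i *\<^sub>R v i) b = (\<Sum>i\<in>I. r i * representation B (v i) b)"
    if "independent B" "\<And>x. x \<in> span B" for B I b and r :: "'a \<Rightarrow> real" and v :: "'a \<Rightarrow> 'a"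
    using that by (simp add: real_vector.representation_sum real_vector.representation_scale)
  have "trace_wrt B f = (\<Sum>b\<in>B. \<Sum>c\<in>C. representation C b c * representation B (f c) b)"
    unfolding trace_wrt_def
  proof (rule sum.cong[OF refl])
    fix b assume "b \<in> B"
    have "f b = f (\<Sum>c\<in>C. representation C b c *\<^sub>R c)"
      using real_vector.sum_representation_eq[OF fC(2) sC fC(1) order_refl, of b] by simp
    also have "\<dots> = (\<Sum>c\<in>C. representation C b c *\<^sub>R f c)"
      by (simp add: linear_sum[OF f] linear_scale[OF f])
    finally show "representation B (f b) b
        = (\<Sum>c\<in>C. representation C b c * representation B (f c) b)"
      using repr_sum[OF fB(2) sB] by simp
  qed
  also have "\<dots> = (\<Sum>c\<in>C. \<Sum>b\<in>B. representation B (f c) b * representation C b c)"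
    by (subst sum.swap) (simp add: mult.commute)
  also have "\<dots> = (\<Sum>c\<in>C. representation C (\<Sum>b\<in>B. representation B (f c) b *\<^sub>R b) c)"
    by (simp add: repr_sum[OF fC(2) sC])
  also have "\<dots> = trace_wrt C f"
    unfolding trace_wrt_def
    using real_vector.sum_representation_eq[OF fB(2) sB fB(1) order_refl] by simp
  finally show ?thesis .
qed

lemma endo_trace_eq:
  assumes "is_finite_basis B" "linear f"
  shows "endo_trace f = (\<Sum>b\<in>B. representation B (f b) b)"
proof -
  have "is_finite_basis (SOME B :: 'a set. is_finite_basis B)"
    using assms(1) by (rule someI)
  then show ?thesis
    unfolding endo_trace_def using trace_wrt_basis_independent assms trace_wrt_def by metis
qed


section \<open>Lie algebras and symplectic Lie algebras\<close>

locale lie_algebra =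
  fixes br :: "'a::real_vector \<Rightarrow> 'a \<Rightarrow> 'a"
  assumes bilinear_br: "bilinear br"
    and br_self: "br x x = 0"
    and jacobi: "br x (br y z) + br y (br z x) + br z (br x y) = 0"
begin

text \<open>Lower central series, beginning with the whole algebra at index \<open>0\<close>.\<close>

primrec lower_central :: "nat \<Rightarrow> 'a set" where
  "lower_central 0 = UNIV"
| "lower_central (Suc n) = span {br x y | x y. y \<in> lower_central n}"

definition nilpotent :: bool
  where "nilpotent \<longleftrightarrow> (\<exists>n. lower_central n = {0})"

end

locale symplectic_lie_algebra = lie_algebra br
  for br :: "'a::real_vector \<Rightarrow> 'a \<Rightarrow> 'a" +
  fixes \<omega> :: "'a \<Rightarrow> 'a \<Rightarrow> real"
  assumes finite_dim: "\<exists>B :: 'a set. is_finite_basis B"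
    and bilinear_omega: "bilinear \<omega>"
    and omega_self: "\<omega> x x = 0"
    and nondegenerate: "(\<And>y. \<omega> x y = 0) \<Longrightarrow> x = 0"
    and cocycle: "\<omega> (br x y) z + \<omega> (br y z) x + \<omega> (br z x) y = 0"
begin

text \<open>
  The left-symmetric product. Existence and uniqueness of the described vector are
  \<open>lsa_prod_ex1\<close>.
\<close>

definition lsa_prod :: "'a \<Rightarrow> 'a \<Rightarrow> 'a"
  where "lsa_prod x y = (THE p. \<forall>z. \<omega> p z = - \<omega> y (br x z))"

text \<open>\<open>nabla x y\<close> is the covariant derivative of \<open>y\<close> along \<open>x\<close>.\<close>

definition nabla :: "'a \<Rightarrow> 'a \<Rightarrow> 'a"
  where "nabla x y = (2/3) *\<^sub>R lsa_prod x y - (1/3) *\<^sub>R lsa_prod y x"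

end

section \<open>Curvature and Ricci tensor of a left-invariant connection\<close>

definition curvature ::
    "('a::real_vector \<Rightarrow> 'a \<Rightarrow> 'a) \<Rightarrow> ('a \<Rightarrow> 'a \<Rightarrow> 'a) \<Rightarrow> 'a \<Rightarrow> 'a \<Rightarrow> 'a \<Rightarrow> 'a"
  where "curvature br D x y z = D x (D y z) - D y (D x z) - D (br x y) z"

definition ricci ::
    "('a::real_vector \<Rightarrow> 'a \<Rightarrow> 'a) \<Rightarrow> ('a \<Rightarrow> 'a \<Rightarrow> 'a) \<Rightarrow> 'a \<Rightarrow> 'a \<Rightarrow> real"
  where "ricci br D x y = endo_trace (\<lambda>z. curvature br D x z y)"


section \<open>The product is left-symmetric; the connection is torsion free and symplectic\<close>

context symplectic_lie_algebra
begin

lemmas br_simps =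
  bilinear_ladd[OF bilinear_br] bilinear_radd[OF bilinear_br]
  bilinear_lsub[OF bilinear_br] bilinear_rsub[OF bilinear_br]
  bilinear_lmul[OF bilinear_br] bilinear_rmul[OF bilinear_br]

lemmas omega_simps =
  bilinear_ladd[OF bilinear_omega] bilinear_radd[OF bilinear_omega]
  bilinear_lsub[OF bilinear_omega] bilinear_rsub[OF bilinear_omega]
  bilinear_lmul[OF bilinear_omega] bilinear_rmul[OF bilinear_omega]

lemma br_skew: "br x y = - br y x"
proof -
  have "br (x + y) (x + y) = br x y + br y x"
    unfolding br_simps by (simp add: br_self)
  then show ?thesis unfolding br_self by (simp add: eq_neg_iff_add_eq_0)
qed

lemma omega_skew: "\<omega> x y = - \<omega> y x"
proof -
  have "\<omega> (x + y) (x + y) = \<omega> x y + \<omega> y x"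
    unfolding omega_simps by (simp add: omega_self)
  then show ?thesis unfolding omega_self by simp
qed

lemma omega_eqI: "(\<And>z. \<omega> x z = \<omega> y z) \<Longrightarrow> x = y"
  using nondegenerate[of "x - y"] by (simp add: omega_simps)

lemma functional_represented:
  assumes g: "linear g"
  shows "\<exists>p. \<forall>z. \<omega> p z = g z"
proof -
  obtain B :: "'a set" where B: "finite B" "independent B" "span B = UNIV"
    using finite_dim by (auto simp: is_finite_basis_def)
  interpret V: finite_dimensional_vector_space "scaleR :: real \<Rightarrow> 'a \<Rightarrow> 'a" B
    rewrites "Vector_Spaces.linear (*\<^sub>R) (*\<^sub>R) = (linear :: ('a \<Rightarrow> 'a) \<Rightarrow> bool)"
      and "module.dependent (*\<^sub>R) = (dependent :: 'a set \<Rightarrow> bool)"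
      and "module.span (*\<^sub>R) = (span :: 'a set \<Rightarrow> 'a set)"
    using B by unfold_locales
      (auto simp: linear_def dependent_raw_def span_raw_def)
  define \<phi> where "\<phi> p = (\<Sum>b\<in>B. \<omega> p b *\<^sub>R b)" for p
  have lin: "linear \<phi>"
    by (rule linearI)
      (simp_all add: \<phi>_def omega_simps scaleR_add_left sum.distrib scaleR_sum_right)
  have coeff: "\<forall>b\<in>B. r b = s b" if "(\<Sum>b\<in>B. r b *\<^sub>R b) = (\<Sum>b\<in>B. s b *\<^sub>R b)"
    for r s :: "'a \<Rightarrow> real"
  proof -
    have "(\<Sum>b\<in>B. (r b - s b) *\<^sub>R b) = 0"
      using that by (simp add: scaleR_diff_left sum_subtractf)
    then show ?thesis
      using real_vector.independentD[OF B(2,1) order_refl, of "\<lambda>b. r b - s b"] by auto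
  qed
  have ext: "\<forall>z. h z = k z" if "linear h" "linear k" "\<forall>b\<in>B. h b = k b" for h k :: "'a \<Rightarrow> real"
    using linear_eq_on[OF that(1,2), of _ B] that(3) B(3) by auto
  have lin_omega: "linear (\<omega> p)" for p
    using bilinear_omega by (auto simp: bilinear_def)
  have "inj \<phi>"
  proof (rule injI)
    fix p q assume "\<phi> p = \<phi> q"
    then have "\<forall>b\<in>B. \<omega> p b = \<omega> q b" unfolding \<phi>_def by (rule coeff)
    then show "p = q" using ext[OF lin_omega lin_omega] omega_eqI by blast
  qed
  then have "surj \<phi>" using V.linear_inj_imp_surj lin by blast
  then obtain p where "\<phi> p = (\<Sum>b\<in>B. g b *\<^sub>R b)" by (metis surjD)
  then have "\<forall>b\<in>B. \<omega> p b = g b" unfolding \<phi>_def by (rule coeff)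
  then show ?thesis using ext[OF lin_omega g] by blast
qed

lemma lsa_prod_ex1: "\<exists>!p. \<forall>z. \<omega> p z = - \<omega> y (br x z)"
proof (rule ex_ex1I)
  show "\<exists>p. \<forall>z. \<omega> p z = - \<omega> y (br x z)"
    by (rule functional_represented, rule linearI) (simp_all add: br_simps omega_simps)
qed (auto intro: omega_eqI)

lemma omega_lsa_prod: "\<omega> (lsa_prod x y) z = - \<omega> y (br x z)"
  using theI'[OF lsa_prod_ex1[of y x]] by (simp add: lsa_prod_def)

lemma lsa_prod_commutator: "lsa_prod x y - lsa_prod y x = br x y"
proof (rule omega_eqI)
  fix z
  show "\<omega> (lsa_prod x y - lsa_prod y x) z = \<omega> (br x y) z"
    using cocycle[of x y z] omega_skew[of "br y z" x] omega_skew[of "br z x" y]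
      br_skew[of z x] bilinear_rneg[OF bilinear_omega, of y "br x z"]
    by (simp add: omega_simps omega_lsa_prod)
qed

lemma lsa_prod_left_symmetric:
  "lsa_prod (lsa_prod x y) z - lsa_prod x (lsa_prod y z)
   = lsa_prod (lsa_prod y x) z - lsa_prod y (lsa_prod x z)"
proof (rule omega_eqI)
  fix w
  have "br (lsa_prod x y) w - br (lsa_prod y x) w = br (br x y) w"
    by (metis br_simps(3) lsa_prod_commutator)
  also have "\<dots> = br x (br y w) - br y (br x w)"
  proof -
    have "br x (br y w) + br y (br w x) + br w (br x y) = 0" by (rule jacobi)
    moreover have "br w (br x y) = - br (br x y) w" by (rule br_skew)
    moreover have "br y (br w x) = - br y (br x w)"
      by (metis br_skew bilinear_rneg[OF bilinear_br])
    ultimately show ?thesis by (simp add: algebra_simps)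
  qed
  finally have "\<omega> z (br (lsa_prod x y) w) - \<omega> z (br (lsa_prod y x) w)
      = \<omega> z (br x (br y w)) - \<omega> z (br y (br x w))"
    by (metis omega_simps(4))
  then show "\<omega> (lsa_prod (lsa_prod x y) z - lsa_prod x (lsa_prod y z)) w
      = \<omega> (lsa_prod (lsa_prod y x) z - lsa_prod y (lsa_prod x z)) w"
    by (simp add: omega_simps omega_lsa_prod)
qed

lemma nabla_torsion_free: "nabla x y - nabla y x = br x y"
proof -
  have "nabla x y - nabla y x = lsa_prod x y - lsa_prod y x"
    by (simp add: nabla_def algebra_simps flip: scaleR_add_left)
  then show ?thesis by (simp add: lsa_prod_commutator)
qed

lemma nabla_symplectic: "\<omega> (nabla x y) z + \<omega> y (nabla x z) = 0"
proof -
  have prods: "lsa_prod y x = lsa_prod x y - br x y" "lsa_prod z x = lsa_prod x z - br x z"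
    using lsa_prod_commutator[of x y] lsa_prod_commutator[of x z] by (auto simp: algebra_simps)
  have "\<omega> y (lsa_prod x z) = \<omega> z (br x y)"
    using omega_skew[of y "lsa_prod x z"] by (simp add: omega_lsa_prod)
  then show ?thesis
    using omega_skew[of "br x y" z]
    by (simp add: nabla_def prods omega_simps omega_lsa_prod algebra_simps)
qed

end

end

theory Submission
  imports Defs
begin

text \<open>
  Write \<open>L\<^sub>x\<close> and \<open>R\<^sub>x\<close> for left and right multiplication by \<open>x\<close>. The definition of the product says
  that the \<open>\<omega>\<close>-adjoint of \<open>L\<^sub>x\<close> is \<open>- ad\<^sub>x = R\<^sub>x - L\<^sub>x\<close>; hence \<open>R\<^sub>x\<close> is self-adjoint. An endomorphism
  and its adjoint have the same trace, so \<open>tr R\<^sub>x = 2 tr L\<^sub>x\<close> and \<open>tr (R\<^sub>x R\<^sub>y) = 2 tr (L\<^sub>x R\<^sub>y)\<close>, while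
  left symmetry gives \<open>tr L\<^bsub>[x,y]\<^esub> = 0\<close> and \<open>tr (R\<^sub>y R\<^sub>x) = tr R\<^bsub>xy\<^esub>\<close>. These identities reduce the
  expansion of the Ricci tensor to \<open>tr L\<^bsub>xy\<^esub>\<close> and \<open>tr (L\<^sub>x L\<^sub>y)\<close>. Passing to adjoints once more turns
  these two into \<open>- tr ad\<^bsub>xy\<^esub>\<close> and \<open>tr (ad\<^sub>y ad\<^sub>x)\<close>, which vanish in the nilpotent case because
  the operators strictly descend along the lower central series.
\<close>

section \<open>Traces\<close>

context
  fixes B :: "'a::real_vector set"
  assumes B: "is_finite_basis B"
begin

lemma finite_basis: "finite B" and independent_basis: "independent B"
  and in_span_basis: "x \<in> span B"
  using B by (auto simp: is_finite_basis_def)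

lemma basis_expansion: "(\<Sum>b\<in>B. representation B x b *\<^sub>R b) = x"
  using real_vector.sum_representation_eq[OF independent_basis in_span_basis finite_basis order_refl] .

lemma linear_representation: "linear (\<lambda>x. representation B x b)"
  by (rule linearI)
    (simp_all add: real_vector.representation_add real_vector.representation_scale
      independent_basis in_span_basis)

lemma endo_trace_add:
  fixes f g :: "'a \<Rightarrow> 'a"
  assumes "linear f" "linear g"
  shows "endo_trace (\<lambda>x. f x + g x) = endo_trace f + endo_trace g"
  by (simp add: endo_trace_eq[OF B] assms linear_compose_add linear_add[OF linear_representation]
      sum.distrib)

lemma endo_trace_scaleR:
  fixes f :: "'a \<Rightarrow> 'a"
  assumes "linear f"
  shows "endo_trace (\<lambda>x. c *\<^sub>R f x) = c * endo_trace f"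
  by (simp add: endo_trace_eq[OF B] assms linear_compose_scale_right
      linear_scale[OF linear_representation] sum_distrib_left)

lemma endo_trace_diff:
  fixes f g :: "'a \<Rightarrow> 'a"
  assumes "linear f" "linear g"
  shows "endo_trace (\<lambda>x. f x - g x) = endo_trace f - endo_trace g"
  by (simp add: endo_trace_eq[OF B] assms linear_compose_sub linear_diff[OF linear_representation]
      sum_subtractf)

lemma endo_trace_neg:
  fixes f :: "'a \<Rightarrow> 'a"
  assumes "linear f"
  shows "endo_trace (\<lambda>x. - f x) = - endo_trace f"
  using endo_trace_scaleR[OF assms, of "-1"] by simp

text \<open>Both traces are double sums of products of matrix entries; swapping the two summations
  turns one into the other.\<close>

lemma endo_trace_commute:
  fixes f g :: "'a \<Rightarrow> 'a"
  assumes f: "linear f" and g: "linear g"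
  shows "endo_trace (\<lambda>x. f (g x)) = endo_trace (\<lambda>x. g (f x))"
proof -
  have expand: "endo_trace (\<lambda>x. h (k x))
      = (\<Sum>b\<in>B. \<Sum>c\<in>B. representation B (k b) c * representation B (h c) b)"
    if h: "linear h" and k: "linear k" for h k :: "'a \<Rightarrow> 'a"
  proof -
    have "representation B (h (k b)) b
        = (\<Sum>c\<in>B. representation B (k b) c * representation B (h c) b)" for b
    proof -
      have "h (k b) = h (\<Sum>c\<in>B. representation B (k b) c *\<^sub>R c)"
        by (simp add: basis_expansion)
      then show ?thesis
        by (simp add: linear_sum[OF h] linear_scale[OF h]
            linear_sum[OF linear_representation] linear_scale[OF linear_representation])
    qed
    then show ?thesis
      using endo_trace_eq[OF B linear_compose[OF k h]] by (simp add: o_def)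
  qed
  show ?thesis
    unfolding expand[OF f g] expand[OF g f] by (subst sum.swap) (simp add: mult.commute)
qed

end

text \<open>
  In a basis extending bases of the successive \<open>V n\<close>, starting from the smallest, \<open>f\<close> is strictly
  triangular.
\<close>

lemma endo_trace_filtration:
  fixes f :: "'a::real_vector \<Rightarrow> 'a" and V :: "nat \<Rightarrow> 'a set"
  assumes fin: "\<exists>B :: 'a set. is_finite_basis B" and f: "linear f"
    and V0: "V 0 = UNIV" and VN: "V N = {0}" and sub: "\<And>n. subspace (V n)"
    and anti: "\<And>n. V (Suc n) \<subseteq> V n" and fV: "\<And>n. f ` V n \<subseteq> V (Suc n)"
  shows "endo_trace f = 0"
proof -
  \<comment> \<open>The basis grows upwards from \<open>V N\<close>, so \<open>n\<close> counts the
    levels already climbed.\<close>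
  have "\<exists>B. independent B \<and> span B = V (N - n) \<and> (\<forall>b\<in>B. representation B (f b) b = 0)" for n
  proof (induction n)
    case 0
    show ?case by (rule exI[of _ "{}"]) (simp add: VN independent_empty)
  next
    case (Suc n)
    show ?case
    proof (cases "n < N")
      \<comment> \<open>Truncated subtraction: both levels are \<open>0\<close>, so the basis is
        already complete.\<close>
      case False
      then show ?thesis using Suc by simp
    next
      case True
      define m where "m = N - Suc n"
      have m: "N - n = Suc m" using True by (simp add: m_def)
      obtain B where B: "independent B" "span B = V (Suc m)"
        "\<forall>b\<in>B. representation B (f b) b = 0"
        using Suc m by auto
      have "B \<subseteq> V m" using B(2) anti[of m] span_superset[of B] by blast
      then obtain B' where B': "B \<subseteq> B'" "B' \<subseteq> V m" "independent B'" "V m \<subseteq> span B'"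
        using real_vector.maximal_independent_subset_extend[OF _ B(1)] by metis
      have span': "span B' = V m"
        using B'(2,4) sub span_minimal by blast
      have "representation B' (f b) b = 0" if b: "b \<in> B'" for b
      proof -
        \<comment> \<open>\<open>f b\<close> lies in the next smaller space, spanned by
          \<open>B\<close>: a new vector \<open>b\<close> gets coefficient \<open>0\<close>, an old
          one keeps its coefficient from the induction.\<close>
        have "f b \<in> span B" using b B'(2) fV[of m] B(2) by blast
        then have rep: "representation B' (f b) = representation B (f b)"
          using real_vector.representation_extend[OF B'(3) _ B'(1)] by blast
        show ?thesis
        proof (cases "b \<in> B")
          case True
          then show ?thesis using rep B(3) by simp
        next
          case False
          then show ?thesis using rep real_vector.representation_ne_zero by metis
        qed
      qed
      then show ?thesis using B'(3) span' m_def by blast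
    qed
  qed
  from this[of N] obtain B where B: "independent B" "span B = UNIV"
    "\<forall>b\<in>B. representation B (f b) b = 0"
    by (auto simp: V0)
  have "finite B"
  proof -
    obtain C :: "'a set" where "finite C" "span C = UNIV"
      using fin by (auto simp: is_finite_basis_def)
    then show ?thesis
      using real_vector.independent_span_bound[of C B] B(1) by auto
  qed
  then have "is_finite_basis B" using B by (simp add: is_finite_basis_def)
  then show ?thesis using B(3) by (simp add: endo_trace_eq f)
qed

section \<open>Adjoints and the Ricci tensor\<close>

context lie_algebra
begin

lemma linear_br: "linear (br x)"
  using bilinear_br by (simp add: bilinear_def)

lemma subspace_lower_central: "subspace (lower_central n)"
  by (cases n) auto

lemma br_lower_central: "y \<in> lower_central n \<Longrightarrow> br x y \<in> lower_central (Suc n)"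
  by (auto intro: span_base)

lemma lower_central_antimono: "lower_central (Suc n) \<subseteq> lower_central n"
proof (induction n)
  case (Suc n)
  then have "{br x y | x y. y \<in> lower_central (Suc n)} \<subseteq> {br x y | x y. y \<in> lower_central n}"
    by blast
  then show ?case using span_mono by simp
qed simp

end

section \<open>Adjoints with respect to \<open>\<omega>\<close>\<close>

context symplectic_lie_algebra
begin

lemma endo_trace_adjoint:
  assumes f: "linear f" and g: "linear g" and adj: "\<And>x y. \<omega> (f x) y = \<omega> x (g y)"
  shows "endo_trace f = endo_trace g"
proof -
  obtain B :: "'a set" where B: "is_finite_basis B" using finite_dim by blast
  \<comment> \<open>\<open>d\<close> is the \<open>\<omega>\<close>-dual basis; expanding in both bases makes the two traces the same double sum.\<close>
  have "\<exists>d. \<forall>b z. \<omega> (d b) z = representation B z b"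
    using functional_represented[OF linear_representation[OF B]] by metis
  then obtain d where d: "\<And>b z. \<omega> (d b) z = representation B z b" by blast
  have lin_omega: "linear (\<omega> p)" "linear (\<lambda>p. \<omega> p q)" for p q
    using bilinear_omega by (auto simp: bilinear_def)
  have dual: "z = (\<Sum>b\<in>B. \<omega> z b *\<^sub>R d b)" for z
  proof (rule omega_eqI)
    fix w
    have "\<omega> z w = \<omega> z (\<Sum>b\<in>B. representation B w b *\<^sub>R b)"
      by (simp add: basis_expansion[OF B])
    also have "\<dots> = \<omega> (\<Sum>b\<in>B. \<omega> z b *\<^sub>R d b) w"
      by (simp add: linear_sum[OF lin_omega(1)] linear_sum[OF lin_omega(2)] omega_simps d
          mult.commute)
    finally show "\<omega> z w = \<omega> (\<Sum>b\<in>B. \<omega> z b *\<^sub>R d b) w" .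
  qed
  \<comment> \<open>Pairing with \<open>d b\<close> reads off the coefficient at \<open>b\<close>,
    and the adjoint relation moves \<open>g\<close> across as \<open>f\<close>.\<close>
  have "endo_trace g = (\<Sum>b\<in>B. \<omega> (f (d b)) b)"
    by (simp add: endo_trace_eq[OF B g] adj d)
  also have "\<dots> = (\<Sum>b\<in>B. \<Sum>c\<in>B. \<omega> c b * \<omega> (d c) (f (d b)))"
  proof (rule sum.cong[OF refl])
    fix b
    have "\<omega> (f (d b)) b = \<omega> (\<Sum>c\<in>B. representation B (f (d b)) c *\<^sub>R c) b"
      by (simp add: basis_expansion[OF B])
    then show "\<omega> (f (d b)) b = (\<Sum>c\<in>B. \<omega> c b * \<omega> (d c) (f (d b)))"
      by (simp add: linear_sum[OF lin_omega(2)] omega_simps d mult.commute)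
  qed
  \<comment> \<open>Summing over \<open>b\<close> first lets \<open>dual\<close> reassemble
    \<open>c\<close>, which leaves the diagonal coefficients of \<open>f\<close>.\<close>
  also have "\<dots> = (\<Sum>c\<in>B. \<omega> (d c) (f (\<Sum>b\<in>B. \<omega> c b *\<^sub>R d b)))"
    by (subst sum.swap)
      (simp add: linear_sum[OF f] linear_scale[OF f] linear_sum[OF lin_omega(1)] omega_simps)
  also have "\<dots> = endo_trace f"
    by (simp add: endo_trace_eq[OF B f] d flip: dual)
  finally show ?thesis by simp
qed

text \<open>By nondegeneracy each law may be tested by pairing with \<open>\<omega>\<close>, where
  it reduces to bilinearity of \<open>\<omega>\<close> and \<open>br\<close>.\<close>

lemma bilinear_lsa_prod: "bilinear lsa_prod"
  unfolding bilinear_def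
  by (intro conjI allI linearI omega_eqI) (simp_all add: omega_lsa_prod omega_simps br_simps)

lemma linear_lsa_prod: "linear (lsa_prod x)" "linear (\<lambda>z. lsa_prod z x)"
  using bilinear_lsa_prod by (simp_all add: bilinear_def)

lemmas lsa_prod_simps =
  bilinear_ladd[OF bilinear_lsa_prod] bilinear_radd[OF bilinear_lsa_prod]
  bilinear_lsub[OF bilinear_lsa_prod] bilinear_rsub[OF bilinear_lsa_prod]
  bilinear_lmul[OF bilinear_lsa_prod] bilinear_rmul[OF bilinear_lsa_prod]

text \<open>Taking adjoints exchanges \<open>L\<^sub>x\<close> and \<open>- ad\<^sub>x\<close>,
  hence fixes their sum \<open>R\<^sub>x\<close>.\<close>

lemma omega_lsa_prod_right: "\<omega> (lsa_prod z x) w = \<omega> z (lsa_prod w x)"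
proof -
  have "lsa_prod z x = lsa_prod x z - br x z" "br x w = lsa_prod x w - lsa_prod w x"
    using lsa_prod_commutator[of x z] lsa_prod_commutator[of x w] by (auto simp: algebra_simps)
  then show ?thesis
    using omega_skew[of z "lsa_prod x w"] omega_skew[of "br x z" w]
    by (simp add: omega_simps omega_lsa_prod)
qed

section \<open>Trace identities for multiplication operators\<close>

lemma linear_compositions:
  "linear (\<lambda>z. lsa_prod x (lsa_prod y z))" "linear (\<lambda>z. lsa_prod x (lsa_prod z y))"
  "linear (\<lambda>z. lsa_prod (lsa_prod y z) x)" "linear (\<lambda>z. lsa_prod (lsa_prod z y) x)"
  using linear_compose[OF linear_lsa_prod(1) linear_lsa_prod(1), of x y]
    linear_compose[OF linear_lsa_prod(2) linear_lsa_prod(1), of x y]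
    linear_compose[OF linear_lsa_prod(1) linear_lsa_prod(2), of x y]
    linear_compose[OF linear_lsa_prod(2) linear_lsa_prod(2), of x y]
  by (simp_all add: o_def)

lemmas trace_simps =
  endo_trace_add[OF someI_ex[OF finite_dim]] endo_trace_diff[OF someI_ex[OF finite_dim]]
  endo_trace_scaleR[OF someI_ex[OF finite_dim]] endo_trace_neg[OF someI_ex[OF finite_dim]]

lemmas trace_commute = endo_trace_commute[OF someI_ex[OF finite_dim]]

lemmas linear_intros =
  linear_lsa_prod linear_compositions linear_compose_add linear_compose_sub
  linear_compose_scale_right

text \<open>The adjoint of \<open>L\<^sub>x\<close> is \<open>R\<^sub>x - L\<^sub>x\<close>, so
  \<open>tr L\<^sub>x = tr R\<^sub>x - tr L\<^sub>x\<close>.\<close>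

lemma trace_right_mult: "endo_trace (\<lambda>z. lsa_prod z x) = 2 * endo_trace (lsa_prod x)"
proof -
  have "endo_trace (lsa_prod x) = endo_trace (\<lambda>z. lsa_prod z x - lsa_prod x z)"
    by (rule endo_trace_adjoint)
      (simp_all add: linear_intros omega_lsa_prod omega_simps flip: lsa_prod_commutator)
  then show ?thesis by (simp add: trace_simps linear_intros)
qed

text \<open>The adjoint of \<open>L\<^sub>x R\<^sub>y\<close> is
  \<open>R\<^sub>y (R\<^sub>x - L\<^sub>x)\<close>, with the factors reversed; cyclicity restores
  their order.\<close>

lemma trace_right_right:
  "endo_trace (\<lambda>z. lsa_prod (lsa_prod z y) x) = 2 * endo_trace (\<lambda>z. lsa_prod x (lsa_prod z y))"
proof -
  have "endo_trace (\<lambda>z. lsa_prod x (lsa_prod z y))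
      = endo_trace (\<lambda>z. lsa_prod (lsa_prod z x) y - lsa_prod (lsa_prod x z) y)"
  proof (rule endo_trace_adjoint)
    show "\<omega> (lsa_prod x (lsa_prod z y)) w
        = \<omega> z (lsa_prod (lsa_prod w x) y - lsa_prod (lsa_prod x w) y)" for z w
      by (simp add: omega_lsa_prod[of x] omega_lsa_prod_right[of z y] omega_simps lsa_prod_simps
          flip: lsa_prod_commutator)
  qed (simp_all add: linear_intros)
  also have "\<dots> = endo_trace (\<lambda>z. lsa_prod (lsa_prod z y) x) - endo_trace (\<lambda>z. lsa_prod x (lsa_prod z y))"
    by (simp add: trace_simps linear_intros
        trace_commute[OF linear_lsa_prod(2)[of y] linear_lsa_prod(2)[of x]]
        trace_commute[OF linear_lsa_prod(2)[of y] linear_lsa_prod(1)[of x]])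
  finally show ?thesis by simp
qed

text \<open>By left symmetry the difference of the two operators is the commutator of
  \<open>L\<^sub>x\<close> and \<open>L\<^sub>y\<close>, which is traceless.\<close>

lemma trace_left_mult_commutator:
  "endo_trace (lsa_prod (lsa_prod x y)) = endo_trace (lsa_prod (lsa_prod y x))"
proof -
  have "(\<lambda>z. lsa_prod (lsa_prod x y) z - lsa_prod (lsa_prod y x) z)
      = (\<lambda>z. lsa_prod x (lsa_prod y z) - lsa_prod y (lsa_prod x z))"
    using lsa_prod_left_symmetric by (auto simp: fun_eq_iff algebra_simps)
  then have "endo_trace (\<lambda>z. lsa_prod (lsa_prod x y) z - lsa_prod (lsa_prod y x) z)
      = endo_trace (\<lambda>z. lsa_prod x (lsa_prod y z) - lsa_prod y (lsa_prod x z))"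
    by simp
  then show ?thesis
    by (simp add: trace_simps linear_intros
        trace_commute[OF linear_lsa_prod(1)[of x] linear_lsa_prod(1)[of y]])
qed

text \<open>Left symmetry, read as an identity of operators in \<open>z\<close>, makes
  \<open>R\<^sub>y R\<^sub>x\<close> minus right multiplication by \<open>lsa_prod x y\<close> the
  commutator of \<open>R\<^sub>y\<close> and \<open>L\<^sub>x\<close>. Their traces thus agree, and
  each is twice one side of the claim.\<close>

lemma trace_left_right:
  "endo_trace (\<lambda>z. lsa_prod x (lsa_prod z y)) = endo_trace (lsa_prod (lsa_prod x y))"
proof -
  have "(\<lambda>z. lsa_prod (lsa_prod z x) y - lsa_prod z (lsa_prod x y))
      = (\<lambda>z. lsa_prod (lsa_prod x z) y - lsa_prod x (lsa_prod z y))"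
    using lsa_prod_left_symmetric by (auto simp: fun_eq_iff)
  then have "endo_trace (\<lambda>z. lsa_prod (lsa_prod z x) y - lsa_prod z (lsa_prod x y))
      = endo_trace (\<lambda>z. lsa_prod (lsa_prod x z) y - lsa_prod x (lsa_prod z y))"
    by simp
  then have "endo_trace (\<lambda>z. lsa_prod (lsa_prod z x) y) = endo_trace (\<lambda>z. lsa_prod z (lsa_prod x y))"
    by (simp add: trace_simps linear_intros
        trace_commute[OF linear_lsa_prod(2)[of y] linear_lsa_prod(1)[of x]])
  then show ?thesis
    using trace_right_right[where x = x and y = y] trace_right_mult[of "lsa_prod x y"]
      trace_commute[OF linear_lsa_prod(2)[of y] linear_lsa_prod(2)[of x]]
    by simp
qed

section \<open>The Ricci tensor of \<open>nabla\<close>\<close>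

lemma ricci_nabla:
  "ricci br nabla x y
   = 1/9 * (endo_trace (lsa_prod (lsa_prod x y)) + endo_trace (lsa_prod x \<circ> lsa_prod y))"
proof -
  \<comment> \<open>With \<open>nabla x y\<close> kept as one vector, the term
    \<open>nabla z w\<close> contributes only \<open>R\<^sub>w\<close> and
    \<open>L\<^sub>w\<close>.\<close>
  define w where "w = nabla x y"
  have w: "lsa_prod w
      = (\<lambda>z. (2/3) *\<^sub>R lsa_prod (lsa_prod x y) z - (1/3) *\<^sub>R lsa_prod (lsa_prod y x) z)"
    by (simp add: w_def nabla_def lsa_prod_simps fun_eq_iff)
  have eq: "(\<lambda>z. curvature br nabla x z y) = (\<lambda>z.
      (4/9) *\<^sub>R lsa_prod x (lsa_prod z y) - (2/9) *\<^sub>R lsa_prod x (lsa_prod y z)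
    - (2/9) *\<^sub>R lsa_prod (lsa_prod z y) x + (1/9) *\<^sub>R lsa_prod (lsa_prod y z) x
    - (2/3) *\<^sub>R lsa_prod z w + (1/3) *\<^sub>R lsa_prod w z
    - (2/3) *\<^sub>R lsa_prod (lsa_prod x z) y + (2/3) *\<^sub>R lsa_prod (lsa_prod z x) y
    + (1/3) *\<^sub>R lsa_prod y (lsa_prod x z) - (1/3) *\<^sub>R lsa_prod y (lsa_prod z x))"
  proof
    fix z
    have "nabla x (nabla z y) = (4/9) *\<^sub>R lsa_prod x (lsa_prod z y) - (2/9) *\<^sub>R lsa_prod x (lsa_prod y z)
        - (2/9) *\<^sub>R lsa_prod (lsa_prod z y) x + (1/9) *\<^sub>R lsa_prod (lsa_prod y z) x"
      by (simp add: nabla_def lsa_prod_simps scaleR_diff_right)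
    moreover have "nabla z (nabla x y) = (2/3) *\<^sub>R lsa_prod z w - (1/3) *\<^sub>R lsa_prod w z"
      unfolding w_def by (subst nabla_def) simp
    moreover have "nabla (br x z) y
        = (2/3) *\<^sub>R lsa_prod (lsa_prod x z) y - (2/3) *\<^sub>R lsa_prod (lsa_prod z x) y
        - (1/3) *\<^sub>R lsa_prod y (lsa_prod x z) + (1/3) *\<^sub>R lsa_prod y (lsa_prod z x)"
      by (simp add: nabla_def lsa_prod_simps scaleR_diff_right flip: lsa_prod_commutator)
    ultimately show "curvature br nabla x z y =
      (4/9) *\<^sub>R lsa_prod x (lsa_prod z y) - (2/9) *\<^sub>R lsa_prod x (lsa_prod y z)
    - (2/9) *\<^sub>R lsa_prod (lsa_prod z y) x + (1/9) *\<^sub>R lsa_prod (lsa_prod y z) x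
    - (2/3) *\<^sub>R lsa_prod z w + (1/3) *\<^sub>R lsa_prod w z
    - (2/3) *\<^sub>R lsa_prod (lsa_prod x z) y + (2/3) *\<^sub>R lsa_prod (lsa_prod z x) y
    + (1/3) *\<^sub>R lsa_prod y (lsa_prod x z) - (1/3) *\<^sub>R lsa_prod y (lsa_prod z x)"
      by (simp add: curvature_def)
  qed
  have expand: "ricci br nabla x y =
      4/9 * endo_trace (\<lambda>z. lsa_prod x (lsa_prod z y))
    - 2/9 * endo_trace (\<lambda>z. lsa_prod x (lsa_prod y z))
    - 2/9 * endo_trace (\<lambda>z. lsa_prod (lsa_prod z y) x)
    + 1/9 * endo_trace (\<lambda>z. lsa_prod (lsa_prod y z) x)
    - 2/3 * endo_trace (\<lambda>z. lsa_prod z w) + 1/3 * endo_trace (lsa_prod w)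
    - 2/3 * endo_trace (\<lambda>z. lsa_prod (lsa_prod x z) y)
    + 2/3 * endo_trace (\<lambda>z. lsa_prod (lsa_prod z x) y)
    + 1/3 * endo_trace (\<lambda>z. lsa_prod y (lsa_prod x z))
    - 1/3 * endo_trace (\<lambda>z. lsa_prod y (lsa_prod z x))"
    unfolding ricci_def eq by (simp add: trace_simps linear_intros)
  have "endo_trace (lsa_prod w)
      = 2/3 * endo_trace (lsa_prod (lsa_prod x y)) - 1/3 * endo_trace (lsa_prod (lsa_prod y x))"
    unfolding w by (simp add: trace_simps linear_intros)
  then have w_trace: "endo_trace (lsa_prod w) = 1/3 * endo_trace (lsa_prod (lsa_prod x y))"
    using trace_left_mult_commutator[of x y] by linarith
  have left_right: "endo_trace (\<lambda>z. lsa_prod x (lsa_prod z y)) = endo_trace (lsa_prod (lsa_prod x y))"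
    "endo_trace (\<lambda>z. lsa_prod y (lsa_prod z x)) = endo_trace (lsa_prod (lsa_prod x y))"
    using trace_left_right[of x y] trace_left_right[of y x] trace_left_mult_commutator[of x y]
    by linarith+
  \<comment> \<open>Only two traces remain. The one of \<open>lsa_prod (lsa_prod x y)\<close> has
    coefficient \<open>(4 - 4 + 1 - 3 - 6 + 12 - 3)/9 = 1/9\<close>, the one of
    \<open>L\<^sub>x L\<^sub>y\<close> has \<open>- 2/9 + 1/3 = 1/9\<close>.\<close>
  show ?thesis
    unfolding expand o_def trace_right_right trace_right_mult w_trace
      trace_commute[OF linear_lsa_prod(2)[of x] linear_lsa_prod(1)[of y]]
      trace_commute[OF linear_lsa_prod(2)[of y] linear_lsa_prod(1)[of x]]
      trace_commute[OF linear_lsa_prod(1)[of y] linear_lsa_prod(1)[of x]]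
      left_right
    by (simp add: field_simps)
qed

section \<open>Vanishing in the nilpotent case\<close>

lemma trace_nilpotent:
  assumes nilpotent and f: "linear f"
    and fC: "\<And>n z. z \<in> lower_central n \<Longrightarrow> f z \<in> lower_central (Suc n)"
  shows "endo_trace f = 0"
proof -
  obtain N where "lower_central N = {0}" using assms(1) by (auto simp: nilpotent_def)
  from endo_trace_filtration[OF finite_dim f lower_central.simps(1) this subspace_lower_central
      lower_central_antimono]
  show ?thesis using fC by (metis image_subsetI)
qed

lemma ricci_nabla_nilpotent:
  assumes nilpotent
  shows "ricci br nabla x y = 0"
proof -
  have "endo_trace (lsa_prod u) = endo_trace (\<lambda>z. - br u z)" for u
    by (rule endo_trace_adjoint)
      (simp_all add: linear_lsa_prod linear_compose_neg linear_br omega_lsa_prod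
        bilinear_rneg[OF bilinear_omega])
  moreover have "endo_trace (br u) = 0" for u
    by (rule trace_nilpotent[OF assms linear_br br_lower_central])
  ultimately have "endo_trace (lsa_prod u) = 0" for u
    by (simp add: trace_simps linear_br)
  \<comment> \<open>The adjoint reverses the factors, and the two minus signs cancel.\<close>
  moreover have "endo_trace (lsa_prod x \<circ> lsa_prod y) = endo_trace (br y \<circ> br x)"
    by (rule endo_trace_adjoint)
      (simp_all add: linear_compose linear_lsa_prod linear_br omega_lsa_prod)
  moreover have "endo_trace (br y \<circ> br x) = 0"
  proof (rule trace_nilpotent[OF assms])
    \<comment> \<open>Two brackets descend two levels; monotonicity of the series gives back the
      extra one.\<close>
    show "(br y \<circ> br x) z \<in> lower_central (Suc n)" if "z \<in> lower_central n" for n z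
      using br_lower_central[OF br_lower_central[OF that]] lower_central_antimono[of "Suc n"]
      unfolding o_def by blast
  qed (simp add: linear_compose linear_br)
  ultimately show ?thesis by (simp add: ricci_nabla)
qed

end

theorem theorem13:
  fixes br :: "'a::real_vector \<Rightarrow> 'a \<Rightarrow> 'a" and \<omega> :: "'a \<Rightarrow> 'a \<Rightarrow> real"
  assumes "symplectic_lie_algebra br \<omega>"
  defines "L \<equiv> symplectic_lie_algebra.lsa_prod br \<omega>"
    and "ric \<equiv> ricci br (symplectic_lie_algebra.nabla br \<omega>)"
  shows "(\<forall>x y. ric x y = 1/9 * (endo_trace (L (L x y)) + endo_trace (L x \<circ> L y))) \<and>
         (lie_algebra.nilpotent br \<longrightarrow> (\<forall>x y. ric x y = 0))"
proof -
  interpret symplectic_lie_algebra br \<omega> by fact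
  show ?thesis
    unfolding L_def ric_def using ricci_nabla ricci_nabla_nilpotent by blast
qed

end
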